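(* There is an absolute constant $c>0$ such that for every integer $N\ge 2$, every set $\mathcal A_N\subset[0,1]^2$ of $N$ points, and every $2\le\alpha<\infty$, \[ \|D_N\|_{\exp(L^\alpha)}\ \ge\ c\,(\log N)^{1-1/\alpha}, \] where $D_N$ is the discrepancy function of $\mathcal A_N$.
   Context: For an $N$-point set $\mathcal A_N\subset[0,1]^2$ and $\vec x=(x_1,x_2)\in[0,1]^2$, the discrepancy function is $D_N(\vec x)=\sharp\big(\mathcal A_N\cap[0,x_1)\times[0,x_2)\big)-N x_1x_2$. For $\alpha\ge 2$, $\exp(L^\alpha)$ denotes the Orlicz space on $[0,1]^2$ (with Lebesgue measure) with norm $\|f\|_{\exp(L^\alpha)}=\inf\{K>0:\int_{[0,1]^2}\psi_\alpha(f/K)\le 1\}$, where $\psi_\alpha(x)=e^{|x|^\alpha}-1$. *)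

theory Defs
  imports "HOL-Analysis.Analysis"
begin

definition unit_square :: "(real \<times> real) set" where
  "unit_square = {0..1} \<times> {0..1}"

definition discrepancy :: "(real \<times> real) set \<Rightarrow> real \<times> real \<Rightarrow> real" where
  "discrepancy A = (\<lambda>(x1, x2).
     real (card (A \<inter> ({0..<x1} \<times> {0..<x2}))) - real (card A) * x1 * x2)"

definition psi :: "real \<Rightarrow> real \<Rightarrow> real" where
  "psi \<alpha> x = exp (\<bar>x\<bar> powr \<alpha>) - 1"

text \<open>The integral of the nonnegative function \<open>psi \<alpha> (f / K)\<close> is taken in the extended
  nonnegative reals, so that it is \<open>\<infinity>\<close> when \<open>psi \<alpha> (f / K)\<close> is measurable but not integrable;
  likewise the norm is \<open>\<infinity>\<close> when no \<open>K\<close> is admissible.\<close>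

definition exp_L_norm :: "real \<Rightarrow> (real \<times> real \<Rightarrow> real) \<Rightarrow> ennreal" where
  "exp_L_norm \<alpha> f =
     Inf (ennreal ` {K. K > 0 \<and>
       (\<integral>\<^sup>+ x. ennreal (psi \<alpha> (f x / K)) \<partial>(lebesgue_on unit_square)) \<le> 1})"

end

theory Submission
  imports Defs
begin

text \<open>Halasz' Riesz product argument. Fix \<open>n\<close> with \<open>2 N \<le> 2^n \<le> 4 N\<close> and, for each \<open>m \<le> n\<close>, let
  \<open>f\<^sub>m\<close> be minus the sum of the Haar functions of all point-free dyadic boxes of size
  \<open>2^-m \<times> 2^-(n-m)\<close>. At least half of the boxes are point-free, so \<open>\<integral> D f\<^sub>m\<close> is bounded below by a
  constant. The product \<open>P = \<Prod>(1 + f\<^sub>m / 8)\<close> is a probability density; expanding it, the linear terms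
  contribute a multiple of \<open>n\<close> to \<open>\<integral> D (P - 1)\<close>, while a product of several \<open>f\<^sub>m\<close> oscillates on
  finer boxes, so that the mixed terms form a geometric series too small to cancel the linear ones.
  On the other hand \<open>P \<le> e^n\<close>, so for \<open>T = n^(1/\<alpha>)\<close> and admissible \<open>K\<close> the pointwise
  inequality \<open>x \<le> T + exp (x^\<alpha> - n)\<close> with \<open>x = |D| / K\<close> gives \<open>\<integral> |D| (P + 1) \<le> K (T + 4)\<close>.
  Together, \<open>K\<close> is at least a constant times \<open>n^(1 - 1/\<alpha>)\<close>.\<close>

section \<open>Haar functions\<close>

lemma has_bochner_integral_fst_times_snd:
  fixes f g :: "real \<Rightarrow> real"
  assumes f: "has_bochner_integral lborel f a" and g: "has_bochner_integral lborel g b"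
  shows "has_bochner_integral lborel (\<lambda>z. f (fst z) * g (snd z)) (a * b)"
proof -
  have if1: "integrable lborel f" and ig: "integrable lborel g"
    using f g by (auto simp: has_bochner_integral_iff)
  note [measurable] = borel_measurable_integrable[OF if1] borel_measurable_integrable[OF ig]
  have int: "integrable (lborel \<Otimes>\<^sub>M lborel) (\<lambda>z. f (fst z) * g (snd z))"
  proof (rule lborel_pair.Fubini_integrable)
    show "integrable lborel (\<lambda>x. \<integral>y. norm (f (fst (x, y)) * g (snd (x, y))) \<partial>lborel)"
      using if1 ig by (simp add: abs_mult)
  qed (use ig in auto)
  have "integral\<^sup>L (lborel \<Otimes>\<^sub>M lborel) (\<lambda>z. f (fst z) * g (snd z))
      = (\<integral>x. (\<integral>y. f x * g y \<partial>lborel) \<partial>lborel)"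
    using lborel_pair.integral_fst'[OF int] by simp
  also have "\<dots> = a * b"
    using f g by (simp add: has_bochner_integral_iff)
  finally show ?thesis
    using int by (simp add: has_bochner_integral_iff lborel_prod)
qed

lemma has_bochner_integral_indicator_Ico:
  fixes a b :: real
  assumes "a \<le> b"
  shows "has_bochner_integral lborel (indicator {a..<b} :: real \<Rightarrow> real) (b - a)"
  using assms by (simp add: has_bochner_integral_iff)

lemma has_bochner_integral_ident_indicator_Ico:
  fixes a b :: real
  assumes "a \<le> b"
  shows "has_bochner_integral lborel (\<lambda>x. x * indicator {a..<b} x) ((b\<^sup>2 - a\<^sup>2) / 2)"
proof -
  have "integrable lborel (\<lambda>x. x * indicator {a..b} x)"
    by (rule borel_integrable_atLeastAtMost) auto
  moreover have "(\<integral>x. x * indicator {a..b} x \<partial>lborel) = (b\<^sup>2 - a\<^sup>2) / 2"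
    using integral_power[OF assms, of 1] by (simp add: power2_eq_square)
  ultimately have *: "has_bochner_integral lborel (\<lambda>x. x * indicator {a..b} x) ((b\<^sup>2 - a\<^sup>2) / 2)"
    by (simp add: has_bochner_integral_iff)
  have "AE x in lborel. x * indicator {a..<b} x = (x * indicator {a..b} x :: real)"
    using AE_lborel_singleton[of b] by eventually_elim (auto simp: indicator_def)
  then show ?thesis
    using * by (subst has_bochner_integral_cong_AE[where g="\<lambda>x. x * indicator {a..b} x"]) auto
qed

text \<open>The cut-off to \<open>[0, 1)\<close> lets all later integrals run over the whole line or
  plane. A coordinate equal to 1 falls in the zero region.\<close>

definition rademacher :: "nat \<Rightarrow> real \<Rightarrow> real" where
  "rademacher p x =
     (if 0 \<le> x \<and> x < 1 then if even \<lfloor>2 ^ Suc p * x\<rfloor> then -1 else 1 else 0)"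

text \<open>Haar functions are normalised to sup norm 1. Coding cells by floors turns membership in
  a dyadic interval into an equation between integers.\<close>

definition haar :: "nat \<Rightarrow> nat \<Rightarrow> real \<Rightarrow> real" where
  "haar p i x = (if \<lfloor>2 ^ p * x\<rfloor> = int i then rademacher p x else 0)"

lemma haar_eq_indicator:
  assumes "i < 2 ^ p"
  shows "haar p i = (\<lambda>x. indicator {(real i + 1/2) / 2 ^ p..<(real i + 1) / 2 ^ p} x
                     - indicator {real i / 2 ^ p..<(real i + 1/2) / 2 ^ p} x)"
proof
  fix x :: real
  define t where "t = 2 ^ p * x"
  have iv: "x \<in> {c / 2 ^ p..<d / 2 ^ p} \<longleftrightarrow> c \<le> t \<and> t < d" for c d
    by (auto simp: t_def field_simps)
  have fl: "\<lfloor>t\<rfloor> = int i \<longleftrightarrow> real i \<le> t \<and> t < real i + 1"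
    by (simp add: floor_eq_iff)
  have t2: "\<lfloor>2 ^ Suc p * x\<rfloor> = \<lfloor>2 * t\<rfloor>"
    by (simp add: t_def mult.assoc)
  \<comment> \<open>For \<open>i < 2 ^ p\<close> the cell lies inside \<open>[0, 1)\<close>, so the
    cut-off in \<open>rademacher\<close> is inactive on it.\<close>
  have cell: "0 \<le> x \<and> x < 1" if "real i \<le> t" "t < real i + 1"
  proof -
    have "0 \<le> t" using that by linarith
    moreover have "real i + 1 \<le> 2 ^ p" using assms
      by (metis Suc_leI add.commute of_nat_Suc of_nat_le_iff of_nat_numeral of_nat_power)
    then have "t < 2 ^ p * 1" using that by linarith
    ultimately have "0 \<le> 2 ^ p * x" "2 ^ p * x < 2 ^ p * 1"
      unfolding t_def by auto
    then show ?thesis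
      using zero_le_mult_iff[of "2 ^ p" x] mult_less_cancel_left_pos[of "2 ^ p" x 1]
        zero_less_power[of "2::real" p] by linarith
  qed
  consider "t < real i \<or> real i + 1 \<le> t" | "real i \<le> t" "t < real i + 1/2"
    | "real i + 1/2 \<le> t" "t < real i + 1" by linarith
  then show "haar p i x = indicator {(real i + 1/2) / 2 ^ p..<(real i + 1) / 2 ^ p} x
                     - indicator {real i / 2 ^ p..<(real i + 1/2) / 2 ^ p} x"
  proof cases
    case 1
    then show ?thesis
      unfolding haar_def t_def[symmetric] fl indicator_def iv by auto
  next
    case 2
    have "\<lfloor>2 * t\<rfloor> = 2 * int i" using 2 by (simp add: floor_eq_iff)
    then show ?thesis using 2 cell
      unfolding haar_def t_def[symmetric] fl indicator_def iv rademacher_def t2 by auto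
  next
    case 3
    have "\<lfloor>2 * t\<rfloor> = 2 * int i + 1" using 3 by (simp add: floor_eq_iff)
    then show ?thesis using 3 cell
      unfolding haar_def t_def[symmetric] fl indicator_def iv rademacher_def t2 by auto
  qed
qed

lemma integral_haar:
  assumes "i < 2 ^ p"
  shows "has_bochner_integral lborel (haar p i) 0"
proof -
  have "has_bochner_integral lborel (haar p i)
     (((real i + 1) / 2 ^ p - (real i + 1/2) / 2 ^ p) - ((real i + 1/2) / 2 ^ p - real i / 2 ^ p))"
    unfolding haar_eq_indicator[OF assms]
    by (intro has_bochner_integral_diff has_bochner_integral_indicator_Ico)
       (auto simp: divide_right_mono)
  then show ?thesis by (simp add: field_simps)
qed

text \<open>Two such factors, one per coordinate, give the contribution of the term
  \<open>N x1 x2\<close> of the discrepancy, whence the later constant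
  \<open>16 * 4 ^ (p + q)\<close>.\<close>

lemma integral_ident_haar:
  assumes "i < 2 ^ p"
  shows "has_bochner_integral lborel (\<lambda>x. x * haar p i x) (1 / (4 * 4 ^ p))"
proof -
  let ?a = "real i / 2 ^ p" and ?m = "(real i + 1/2) / 2 ^ p" and ?b = "(real i + 1) / 2 ^ p"
  have "has_bochner_integral lborel (\<lambda>x. x * indicator {?m..<?b} x - x * indicator {?a..<?m} x)
     ((?b\<^sup>2 - ?m\<^sup>2) / 2 - (?m\<^sup>2 - ?a\<^sup>2) / 2)"
    by (intro has_bochner_integral_diff has_bochner_integral_ident_indicator_Ico)
       (auto simp: divide_right_mono)
  moreover have "(?b\<^sup>2 - ?m\<^sup>2) / 2 - (?m\<^sup>2 - ?a\<^sup>2) / 2 = 1 / (4 * (2 ^ p)\<^sup>2)"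
    by (simp add: power_divide field_simps) (simp add: power2_eq_square algebra_simps)
  moreover have "(2 ^ p)\<^sup>2 = (4 ^ p :: real)"
    by (simp add: power2_eq_square flip: power_mult_distrib)
  ultimately show ?thesis
    by (simp add: haar_eq_indicator[OF assms] right_diff_distrib)
qed

text \<open>The threshold \<open>s\<close> lies outside the cell, so \<open>s < x\<close> has a
  constant truth value there. The integrand is either zero or the Haar function itself, whose mean
  is zero.\<close>

lemma integral_less_haar:
  assumes "i < 2 ^ p" and s: "\<lfloor>2 ^ p * s\<rfloor> \<noteq> int i"
  shows "has_bochner_integral lborel (\<lambda>x. of_bool (s < x) * haar p i x) 0"
proof -
  have "(\<lambda>x. of_bool (s < x) * haar p i x) = (\<lambda>x. 0)
     \<or> (\<lambda>x. of_bool (s < x) * haar p i x) = haar p i"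
  proof (cases "\<lfloor>2 ^ p * s\<rfloor> < int i")
    case True
    have "s < x" if "\<lfloor>2 ^ p * x\<rfloor> = int i" for x
    proof (rule ccontr)
      assume "\<not> s < x"
      then have "\<lfloor>2 ^ p * x\<rfloor> \<le> \<lfloor>2 ^ p * s\<rfloor>" by (intro floor_mono) simp
      with True that show False by simp
    qed
    then show ?thesis by (auto simp: haar_def fun_eq_iff)
  next
    case False
    have "\<not> s < x" if "\<lfloor>2 ^ p * x\<rfloor> = int i" for x
    proof
      assume "s < x"
      then have "\<lfloor>2 ^ p * s\<rfloor> \<le> \<lfloor>2 ^ p * x\<rfloor>" by (intro floor_mono) simp
      with False s that show False by simp
    qed
    then show ?thesis by (auto simp: haar_def fun_eq_iff)
  qed
  then show ?thesis
    using integral_haar[OF assms(1)] by auto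
qed

section \<open>Integrals against functions constant on dyadic boxes\<close>

definition cell_const :: "nat \<Rightarrow> nat \<Rightarrow> (real \<times> real \<Rightarrow> real) \<Rightarrow> bool" where
  "cell_const p q G \<longleftrightarrow> (\<forall>z z'. \<lfloor>2 ^ p * fst z\<rfloor> = \<lfloor>2 ^ p * fst z'\<rfloor> \<longrightarrow>
     \<lfloor>2 ^ q * snd z\<rfloor> = \<lfloor>2 ^ q * snd z'\<rfloor> \<longrightarrow> G z = G z')"

text \<open>The coarse cell index is the integer quotient of the fine one by
  \<open>2 ^ (p' - p)\<close>.\<close>

lemma floor_power2_mono:
  fixes x y :: real
  assumes "p \<le> p'" "\<lfloor>2 ^ p' * x\<rfloor> = \<lfloor>2 ^ p' * y\<rfloor>"
  shows "\<lfloor>2 ^ p * x\<rfloor> = \<lfloor>2 ^ p * y\<rfloor>"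
proof -
  have "\<lfloor>2 ^ p * u\<rfloor> = \<lfloor>2 ^ p' * u\<rfloor> div 2 ^ (p' - p)" for u :: real
  proof -
    have "2 ^ p * u = 2 ^ p' * u / real_of_int (2 ^ (p' - p))"
    proof -
      have "(2::real) ^ p' = 2 ^ p * 2 ^ (p' - p)"
        using assms(1) by (simp flip: power_add)
      then show ?thesis by simp
    qed
    then show ?thesis
      by (simp only: floor_divide_real_eq_div zero_le_power zero_le_numeral)
  qed
  then show ?thesis using assms(2) by simp
qed

lemma cell_const_mono:
  assumes "cell_const p q G" "p \<le> p'" "q \<le> q'"
  shows "cell_const p' q' G"
  using assms unfolding cell_const_def by (meson floor_power2_mono)

lemma cell_const_const: "cell_const p q (\<lambda>_. c)"
  by (simp add: cell_const_def)

lemma cell_const_add: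
  "cell_const p q F \<Longrightarrow> cell_const p q G \<Longrightarrow> cell_const p q (\<lambda>z. F z + G z)"
  unfolding cell_const_def by (intro allI impI arg_cong2[where f="(+)"]) blast+

lemma cell_const_mult:
  "cell_const p q F \<Longrightarrow> cell_const p q G \<Longrightarrow> cell_const p q (\<lambda>z. F z * G z)"
  unfolding cell_const_def by (intro allI impI arg_cong2[where f="(*)"]) blast+

lemma cell_const_prod:
  assumes "\<And>r. r \<in> S \<Longrightarrow> cell_const p q (F r)"
  shows "cell_const p q (\<lambda>z. \<Prod>r\<in>S. F r z)"
  unfolding cell_const_def
proof (intro allI impI prod.cong refl)
  fix z z' :: "real \<times> real" and r
  assume "\<lfloor>2 ^ p * fst z\<rfloor> = \<lfloor>2 ^ p * fst z'\<rfloor>" "\<lfloor>2 ^ q * snd z\<rfloor> = \<lfloor>2 ^ q * snd z'\<rfloor>" "r \<in> S"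
  then show "F r z = F r z'"
    using assms[of r] unfolding cell_const_def by blast
qed

lemma rademacher_cong:
  assumes "\<lfloor>2 ^ Suc p * x\<rfloor> = \<lfloor>2 ^ Suc p * y\<rfloor>"
  shows "rademacher p x = rademacher p y"
proof -
  \<comment> \<open>The cut-off is itself a condition on the cell at scale 0, hence is determined by
    the finer cell.\<close>
  have "0 \<le> u \<and> u < 1 \<longleftrightarrow> \<lfloor>u\<rfloor> = 0" for u :: real
    by (simp add: floor_eq_iff)
  moreover have "\<lfloor>x\<rfloor> = \<lfloor>y\<rfloor>"
    using floor_power2_mono[of 0 "Suc p" x y] assms by simp
  ultimately show ?thesis
    using assms by (simp only: rademacher_def)
qed

lemma abs_rademacher_le_1: "\<bar>rademacher p x\<bar> \<le> 1"
  by (simp add: rademacher_def)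

lemma cell_const_rademacher_fst: "cell_const (Suc p) q (\<lambda>z. rademacher p (fst z))"
  unfolding cell_const_def by (intro allI impI rademacher_cong)

lemma cell_const_rademacher_snd: "cell_const p (Suc q) (\<lambda>z. rademacher q (snd z))"
  unfolding cell_const_def by (intro allI impI rademacher_cong)

lemma floor_cell_obtain:
  fixes x :: real
  assumes "0 \<le> x" "x < 1"
  obtains i where "i < 2 ^ p" "\<lfloor>2 ^ p * x\<rfloor> = int i"
proof
  have "2 ^ p * x < 2 ^ p * 1" using assms by (intro mult_strict_left_mono) auto
  then have "\<lfloor>2 ^ p * x\<rfloor> < 2 ^ p" by (simp add: floor_less_iff)
  moreover have "0 \<le> \<lfloor>2 ^ p * x\<rfloor>" using assms by simp
  ultimately show "nat \<lfloor>2 ^ p * x\<rfloor> < 2 ^ p" "\<lfloor>2 ^ p * x\<rfloor> = int (nat \<lfloor>2 ^ p * x\<rfloor>)"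
    by (auto simp: nat_less_iff)
qed

text \<open>Only the summand of the cell containing \<open>z\<close> survives, and on that cell
  \<open>G\<close> equals its value at the lower left corner.\<close>

lemma cell_const_haar_expansion:
  assumes "cell_const p q G"
  shows "G z * (rademacher p (fst z) * rademacher q (snd z)) =
    (\<Sum>i<2^p. \<Sum>j<2^q. G (real i / 2 ^ p, real j / 2 ^ q) * (haar p i (fst z) * haar q j (snd z)))"
    (is "?L = ?R")
proof (cases "rademacher p (fst z) = 0 \<or> rademacher q (snd z) = 0")
  case True
  then have "haar p i (fst z) * haar q j (snd z) = 0" for i j :: nat
    by (auto simp: haar_def)
  note zero = this
  have "?L = 0" using True by auto
  moreover have "?R = 0" unfolding zero by simp
  ultimately show ?thesis by simp
next
  case False
  then have "0 \<le> fst z" "fst z < 1" "0 \<le> snd z" "snd z < 1"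
    by (auto simp: rademacher_def split: if_splits)
  note range = this
  obtain i where i: "i < 2 ^ p" "\<lfloor>2 ^ p * fst z\<rfloor> = int i"
    using floor_cell_obtain[OF range(1,2)] .
  obtain j where j: "j < 2 ^ q" "\<lfloor>2 ^ q * snd z\<rfloor> = int j"
    using floor_cell_obtain[OF range(3,4)] .
  have hi: "haar p i' (fst z) = (if i' = i then rademacher p (fst z) else 0)" for i'
    using i by (auto simp: haar_def)
  have hj: "haar q j' (snd z) = (if j' = j then rademacher q (snd z) else 0)" for j'
    using j by (auto simp: haar_def)
  define X where "X = G (real i / 2 ^ p, real j / 2 ^ q) * (rademacher p (fst z) * rademacher q (snd z))"
  have "?R = (\<Sum>i'<2^p. \<Sum>j'<2^q. if i' = i then if j' = j then X else 0 else 0)"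
    unfolding hi hj by (intro sum.cong refl) (auto simp: X_def)
  also have "\<dots> = (\<Sum>i'<2^p. if i' = i then X else 0)"
    using j(1) by (intro sum.cong refl) auto
  also have "\<dots> = X"
    using i(1) by simp
  also have "X = G (real i / 2 ^ p, real j / 2 ^ q) * (rademacher p (fst z) * rademacher q (snd z))"
    by (simp add: X_def)
  also have "G (real i / 2 ^ p, real j / 2 ^ q) = G z"
    using assms[unfolded cell_const_def, rule_format, of z "(real i / 2 ^ p, real j / 2 ^ q)"] i(2) j(2)
    by simp
  finally show ?thesis by simp
qed

text \<open>The weight \<open>W\<close> need only be integrated over cells on which \<open>G\<close>
  is nonzero. For the discrepancy these will be point-free cells, which all give the same value
  \<open>v\<close>.\<close>

lemma has_bochner_integral_cell_const:
  assumes G: "cell_const p q G"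
    and W: "\<And>i j. i < 2 ^ p \<Longrightarrow> j < 2 ^ q \<Longrightarrow> G (real i / 2 ^ p, real j / 2 ^ q) \<noteq> 0 \<Longrightarrow>
      has_bochner_integral lborel (\<lambda>z. W z * (haar p i (fst z) * haar q j (snd z))) v"
  shows "has_bochner_integral lborel
    (\<lambda>z. W z * (G z * (rademacher p (fst z) * rademacher q (snd z))))
    ((\<Sum>i<2^p. \<Sum>j<2^q. G (real i / 2 ^ p, real j / 2 ^ q)) * v)"
proof -
  have "has_bochner_integral lborel
      (\<lambda>z. \<Sum>i<2^p. \<Sum>j<2^q. G (real i / 2 ^ p, real j / 2 ^ q) * (W z * (haar p i (fst z) * haar q j (snd z))))
      (\<Sum>i<2^p. \<Sum>j<2^q. G (real i / 2 ^ p, real j / 2 ^ q) * v)"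
  proof (intro has_bochner_integral_sum)
    fix i j :: nat assume "i \<in> {..<2^p}" "j \<in> {..<2^q}"
    then show "has_bochner_integral lborel
      (\<lambda>z. G (real i / 2 ^ p, real j / 2 ^ q) * (W z * (haar p i (fst z) * haar q j (snd z))))
      (G (real i / 2 ^ p, real j / 2 ^ q) * v)"
      using W by (cases "G (real i / 2 ^ p, real j / 2 ^ q) = 0")
        (auto intro: has_bochner_integral_mult_right)
  qed
  then show ?thesis
    by (simp add: cell_const_haar_expansion[OF G] sum_distrib_left sum_distrib_right ac_simps)
qed

section \<open>Discrepancy tested against Haar functions\<close>

lemma discrepancy_eq:
  assumes "A \<subseteq> unit_square" "finite A"
  shows "discrepancy A z = (\<Sum>a\<in>A. of_bool (fst a < fst z) * of_bool (snd a < snd z))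
    - real (card A) * (fst z * snd z)"
proof -
  have "(\<Sum>a\<in>A. of_bool (fst a < fst z) * of_bool (snd a < snd z) :: real)
      = (\<Sum>a\<in>A. if fst a < fst z \<and> snd a < snd z then 1 else 0)"
    by (intro sum.cong) auto
  also have "\<dots> = real (card {a\<in>A. fst a < fst z \<and> snd a < snd z})"
    using assms(2) by (simp add: sum.If_cases Int_def)
  also have "{a\<in>A. fst a < fst z \<and> snd a < snd z} = A \<inter> ({0..<fst z} \<times> {0..<snd z})"
    using assms(1) by (auto simp: unit_square_def)
  finally show ?thesis
    by (simp add: discrepancy_def split_beta mult.assoc)
qed

text \<open>The counting term of each point is a product over the two coordinates. A point outside
  the box misses the cell in some coordinate, and that factor integrates to zero. Only the term
  \<open>N x1 x2\<close> remains.\<close>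

lemma discrepancy_haar:
  assumes A: "A \<subseteq> unit_square" "finite A" and ij: "i < 2 ^ p" "j < 2 ^ q"
    and free: "\<And>a. a \<in> A \<Longrightarrow> \<lfloor>2 ^ p * fst a\<rfloor> = int i \<Longrightarrow> \<lfloor>2 ^ q * snd a\<rfloor> \<noteq> int j"
  shows "has_bochner_integral lborel
    (\<lambda>z. discrepancy A z * (haar p i (fst z) * haar q j (snd z)))
    (- real (card A) / (16 * 4 ^ (p + q)))"
proof -
  have 1: "has_bochner_integral lborel (\<lambda>z. (of_bool (fst a < fst z) * haar p i (fst z))
      * (of_bool (snd a < snd z) * haar q j (snd z))) 0" if a: "a \<in> A" for a
  proof -
    \<comment> \<open>The factor in the other coordinate is multiplied by 0, so only its
      integrability matters.\<close>
    have less: "\<exists>v. has_bochner_integral lborel (\<lambda>x. of_bool (s < x) * haar p i x :: real) v"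
      if "i < 2 ^ p" for s p i
    proof -
      have "integrable lborel (\<lambda>x. indicator {s<..} x *\<^sub>R haar p i x)"
        by (rule integrable_mult_indicator)
           (use integral_haar[OF that] in \<open>auto simp: has_bochner_integral_iff\<close>)
      then have "integrable lborel (\<lambda>x. of_bool (s < x) * haar p i x)"
        by (rule Bochner_Integration.integrable_cong[THEN iffD1, rotated 2]) (auto simp: indicator_def)
      then show ?thesis by (auto simp: has_bochner_integral_iff)
    qed
    consider "\<lfloor>2 ^ p * fst a\<rfloor> \<noteq> int i" | "\<lfloor>2 ^ q * snd a\<rfloor> \<noteq> int j" using free[OF a] by blast
    then show ?thesis
    proof cases
      case 1
      from less[OF ij(2), of "snd a"] obtain v where
        "has_bochner_integral lborel (\<lambda>x. of_bool (snd a < x) * haar q j x) v" by blast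
      from has_bochner_integral_fst_times_snd[OF integral_less_haar[OF ij(1) 1] this]
      show ?thesis by simp
    next
      case 2
      from less[OF ij(1), of "fst a"] obtain v where
        "has_bochner_integral lborel (\<lambda>x. of_bool (fst a < x) * haar p i x) v" by blast
      from has_bochner_integral_fst_times_snd[OF this integral_less_haar[OF ij(2) 2]]
      show ?thesis by simp
    qed
  qed
  have "has_bochner_integral lborel
     (\<lambda>z. (\<Sum>a\<in>A. (of_bool (fst a < fst z) * haar p i (fst z)) * (of_bool (snd a < snd z) * haar q j (snd z)))
        - real (card A) * ((fst z * haar p i (fst z)) * (snd z * haar q j (snd z))))
     ((\<Sum>a\<in>A. 0) - real (card A) * (1 / (4 * 4 ^ p) * (1 / (4 * 4 ^ q))))"
    by (intro has_bochner_integral_diff has_bochner_integral_sum 1 has_bochner_integral_mult_right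
        has_bochner_integral_fst_times_snd integral_ident_haar ij)
  moreover have "(\<Sum>a\<in>A. (of_bool (fst a < fst z) * haar p i (fst z)) * (of_bool (snd a < snd z) * haar q j (snd z)))
        - real (card A) * ((fst z * haar p i (fst z)) * (snd z * haar q j (snd z)))
      = discrepancy A z * (haar p i (fst z) * haar q j (snd z))" for z
    unfolding discrepancy_eq[OF A] left_diff_distrib sum_distrib_right by (simp add: ac_simps)
  ultimately show ?thesis
    by (simp add: power_add)
qed

text \<open>Since \<open>G\<close> is constant on cells and vanishes on \<open>A\<close>, a cell
  with \<open>G\<close> nonzero contains no point of \<open>A\<close>.\<close>

lemma discrepancy_cell_const:
  assumes A: "A \<subseteq> unit_square" "finite A" and G: "cell_const p q G"
    and free: "\<And>a. a \<in> A \<Longrightarrow> G a = 0"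
  shows "has_bochner_integral lborel
    (\<lambda>z. discrepancy A z * (G z * (rademacher p (fst z) * rademacher q (snd z))))
    ((\<Sum>i<2^p. \<Sum>j<2^q. G (real i / 2 ^ p, real j / 2 ^ q)) * (- real (card A) / (16 * 4 ^ (p + q))))"
proof (rule has_bochner_integral_cell_const[OF G])
  fix i j assume ij: "i < 2 ^ p" "j < 2 ^ q" and nz: "G (real i / 2 ^ p, real j / 2 ^ q) \<noteq> 0"
  show "has_bochner_integral lborel
    (\<lambda>z. discrepancy A z * (haar p i (fst z) * haar q j (snd z))) (- real (card A) / (16 * 4 ^ (p + q)))"
  proof (rule discrepancy_haar[OF A ij])
    fix a assume "a \<in> A" "\<lfloor>2 ^ p * fst a\<rfloor> = int i"
    moreover have "G a = G (real i / 2 ^ p, real j / 2 ^ q)"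
      if "\<lfloor>2 ^ p * fst a\<rfloor> = int i" "\<lfloor>2 ^ q * snd a\<rfloor> = int j"
      using that G[unfolded cell_const_def, rule_format, of a "(real i / 2 ^ p, real j / 2 ^ q)"]
      by simp
    ultimately show "\<lfloor>2 ^ q * snd a\<rfloor> \<noteq> int j"
      using free nz by fastforce
  qed
qed

lemma integral_cell_const:
  assumes "cell_const p q G"
  shows "has_bochner_integral lborel (\<lambda>z. G z * (rademacher p (fst z) * rademacher q (snd z))) 0"
  using has_bochner_integral_cell_const[OF assms, of "\<lambda>_. 1" 0]
    has_bochner_integral_fst_times_snd[OF integral_haar integral_haar] by simp

text \<open>There are \<open>2 ^ (p + q)\<close> cells, each contributing at most
  \<open>B * N / (16 * 4 ^ (p + q))\<close>. Finer cells therefore give smaller integrals.\<close>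

lemma abs_integral_discrepancy_cell_const_le:
  assumes A: "A \<subseteq> unit_square" "finite A" and G: "cell_const p q G"
    and free: "\<And>a. a \<in> A \<Longrightarrow> G a = 0" and B: "\<And>z. \<bar>G z\<bar> \<le> B"
  shows "\<bar>\<integral>z. discrepancy A z * (G z * (rademacher p (fst z) * rademacher q (snd z))) \<partial>lborel\<bar>
    \<le> real (card A) * B / (16 * 2 ^ (p + q))"
proof -
  define S where "S = (\<Sum>i<2^p. \<Sum>j<2^q. G (real i / 2 ^ p, real j / 2 ^ q))"
  have "\<bar>S\<bar> \<le> (\<Sum>i<(2::nat)^p. \<Sum>j<(2::nat)^q. B)"
    unfolding S_def by (intro order_trans[OF sum_abs] sum_mono B)
  also have "\<dots> = 2 ^ (p + q) * B" by (simp add: power_add)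
  finally have S: "\<bar>S\<bar> \<le> 2 ^ (p + q) * B" .
  have "\<bar>\<integral>z. discrepancy A z * (G z * (rademacher p (fst z) * rademacher q (snd z))) \<partial>lborel\<bar>
      = \<bar>S\<bar> * (real (card A) / (16 * 4 ^ (p + q)))"
    using discrepancy_cell_const[OF A G free]
    by (simp add: has_bochner_integral_iff S_def abs_mult)
  also have "\<dots> \<le> (2 ^ (p + q) * B) * (real (card A) / (16 * 4 ^ (p + q)))"
    using S by (intro mult_right_mono) auto
  also have "4 ^ (p + q) = (2 ^ (p + q) * 2 ^ (p + q) :: real)"
    by (simp flip: power_mult_distrib)
  finally show ?thesis by (simp add: mult.commute)
qed

section \<open>The Riesz product\<close>

text \<open>Groups the monomials of the expanded product by their largest index.\<close>

lemma prod_one_plus_expand_last: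
  fixes u :: "nat \<Rightarrow> 'a::comm_ring_1"
  shows "(\<Prod>r<m. 1 + u r) = 1 + (\<Sum>k<m. u k * (\<Prod>r<k. 1 + u r))"
  by (induction m) (simp_all add: algebra_simps)

text \<open>Groups the monomials by their smallest index. Combined with the previous expansion, this
  fixes both extreme indices of a monomial.\<close>

lemma prod_one_plus_expand_first:
  fixes u :: "nat \<Rightarrow> 'a::comm_ring_1"
  shows "(\<Prod>r<m. 1 + u r) = 1 + (\<Sum>a<m. u a * (\<Prod>r\<in>{a<..<m}. 1 + u r))"
proof (induction m)
  case (Suc m)
  have step: "(\<Prod>r\<in>{a<..<Suc m}. 1 + u r) = (1 + u m) * (\<Prod>r\<in>{a<..<m}. 1 + u r)" if "a < m" for a
  proof -
    have "{a<..<Suc m} = insert m {a<..<m}" using that by auto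
    then show ?thesis by simp
  qed
  have "{m<..<Suc m} = {}" by auto
  then have "1 + (\<Sum>a<Suc m. u a * (\<Prod>r\<in>{a<..<Suc m}. 1 + u r))
      = 1 + (1 + u m) * (\<Sum>a<m. u a * (\<Prod>r\<in>{a<..<m}. 1 + u r)) + u m"
    by (simp add: step sum_distrib_left ac_simps)
  then show ?case
    using Suc.IH by (simp add: algebra_simps)
qed simp

text \<open>The upper bound on \<open>card A\<close> keeps half of the \<open>2 ^ n\<close> boxes of
  each shape point-free; the lower bound keeps the main terms from shrinking as \<open>n\<close>
  grows.\<close>

locale riesz_product =
  fixes A :: "(real \<times> real) set" and n :: nat
  assumes A_subset: "A \<subseteq> unit_square" and finite_A: "finite A"
    and card_upper: "2 * card A \<le> 2 ^ n" and card_lower: "2 ^ n \<le> 4 * card A"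
begin

definition blank :: "nat \<Rightarrow> real \<times> real \<Rightarrow> real" where
  "blank m z = of_bool (\<forall>a\<in>A. \<lfloor>2 ^ m * fst a\<rfloor> = \<lfloor>2 ^ m * fst z\<rfloor> \<longrightarrow>
     \<lfloor>2 ^ (n - m) * snd a\<rfloor> \<noteq> \<lfloor>2 ^ (n - m) * snd z\<rfloor>)"

text \<open>The minus sign makes the integral against the discrepancy positive, because
  \<open>N x1 x2\<close> enters the discrepancy negatively.\<close>

definition blank_haar :: "nat \<Rightarrow> real \<times> real \<Rightarrow> real" where
  "blank_haar m z = - (blank m z * (rademacher m (fst z) * rademacher (n - m) (snd z)))"

text \<open>The factors left free once the smallest index \<open>a\<close> and largest index
  \<open>m\<close> are fixed. The weight 1/8 makes products of two or more factors (weight 1/64)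
  small against single ones.\<close>

definition mid_prod :: "nat \<Rightarrow> nat \<Rightarrow> real \<times> real \<Rightarrow> real" where
  "mid_prod a m z = (\<Prod>r\<in>{a<..<m}. 1 + blank_haar r z / 8)"

definition riesz :: "real \<times> real \<Rightarrow> real" where
  "riesz z = (\<Prod>r<Suc n. 1 + blank_haar r z / 8)"

lemma cell_const_blank: "cell_const m (n - m) (blank m)"
  unfolding cell_const_def blank_def by simp

lemma blank_point: "a \<in> A \<Longrightarrow> blank m a = 0"
  unfolding blank_def by auto

lemma abs_blank_le_1: "\<bar>blank m z\<bar> \<le> 1"
  by (simp add: blank_def)

lemma abs_blank_haar_le_1: "\<bar>blank_haar m z\<bar> \<le> 1"
  unfolding blank_haar_def abs_minus_cancel abs_mult
  by (intro mult_le_one abs_blank_le_1 abs_rademacher_le_1 mult_nonneg_nonneg abs_ge_zero)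

lemma cell_const_blank_haar: "cell_const (Suc m) (Suc (n - m)) (blank_haar m)"
proof -
  have "cell_const (Suc m) (Suc (n - m))
      (\<lambda>z. (-1) * (blank m z * (rademacher m (fst z) * rademacher (n - m) (snd z))))"
    by (intro cell_const_mult cell_const_const cell_const_rademacher_fst cell_const_rademacher_snd
        cell_const_mono[OF cell_const_blank]) auto
  then show ?thesis by (simp add: blank_haar_def[abs_def])
qed

lemma mid_factor_bounds: "7/8 \<le> 1 + blank_haar r z / 8" "1 + blank_haar r z / 8 \<le> 9/8"
  using abs_blank_haar_le_1[of r z] by linarith+

lemma abs_mid_prod_le: "\<bar>mid_prod a m z\<bar> \<le> (9/8) ^ (m - Suc a)"
proof -
  have "\<bar>mid_prod a m z\<bar> \<le> (\<Prod>r\<in>{a<..<m}. 9/8)"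
    unfolding mid_prod_def abs_prod
  proof (intro prod_mono conjI abs_ge_zero)
    fix r show "\<bar>1 + blank_haar r z / 8\<bar> \<le> 9/8"
      using mid_factor_bounds[of r z] by linarith
  qed
  then show ?thesis by simp
qed

lemma riesz_nonneg: "0 \<le> riesz z"
  unfolding riesz_def
proof (intro prod_nonneg)
  fix r show "0 \<le> 1 + blank_haar r z / 8" using mid_factor_bounds[of r z] by linarith
qed

lemma riesz_le: "riesz z \<le> (9/8) ^ Suc n"
proof -
  have "riesz z \<le> (\<Prod>r<Suc n. 9/8)"
    unfolding riesz_def
  proof (intro prod_mono conjI)
    fix r show "0 \<le> 1 + blank_haar r z / 8" "1 + blank_haar r z / 8 \<le> 9/8"
      using mid_factor_bounds[of r z] by linarith+
  qed
  then show ?thesis by simp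
qed

text \<open>Thus \<open>riesz z - 1\<close> localises whole-plane integrals to the square, which is
  needed since the discrepancy is not integrable on the plane.\<close>

lemma riesz_outside: "z \<notin> unit_square \<Longrightarrow> riesz z = 1"
proof -
  assume "z \<notin> unit_square"
  then have "rademacher r (fst z) = 0 \<or> rademacher s (snd z) = 0" for r s
    by (cases z) (auto simp: unit_square_def rademacher_def)
  then have "blank_haar r z = 0" for r
    by (auto simp: blank_haar_def)
  then show ?thesis by (simp add: riesz_def)
qed

text \<open>Expand by the largest index \<open>m\<close>, then the remaining product by its smallest
  index \<open>a\<close>; the constant 1 left in the inner expansion yields the linear
  terms.\<close>

lemma riesz_expansion:
  "riesz z - 1 = (\<Sum>m<Suc n. blank_haar m z / 8 +
     (\<Sum>a<m. (blank_haar a z * mid_prod a m z * blank_haar m z) / 64))"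
proof -
  have "riesz z - 1 = (\<Sum>m<Suc n. blank_haar m z / 8 * (\<Prod>r<m. 1 + blank_haar r z / 8))"
    unfolding riesz_def prod_one_plus_expand_last[of _ "Suc n"] by simp
  also have "\<dots> = (\<Sum>m<Suc n. blank_haar m z / 8 *
      (1 + (\<Sum>a<m. blank_haar a z / 8 * mid_prod a m z)))"
    unfolding prod_one_plus_expand_first mid_prod_def ..
  also have "\<dots> = (\<Sum>m<Suc n. blank_haar m z / 8 +
     (\<Sum>a<m. (blank_haar a z * mid_prod a m z * blank_haar m z) / 64))"
    by (intro sum.cong refl) (simp add: distrib_left sum_distrib_left ac_simps)
  finally show ?thesis .
qed

text \<open>In \<open>blank_haar a * mid_prod a m * blank_haar m\<close> the finest horizontal oscillation comes from
  \<open>m\<close> and the finest vertical one from \<open>a\<close>; everything else is constant on dyadic boxes of size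
  \<open>2^-m \<times> 2^-(n-a)\<close>.\<close>

definition cross_coeff :: "nat \<Rightarrow> nat \<Rightarrow> real \<times> real \<Rightarrow> real" where
  "cross_coeff a m z = blank a z * blank m z * mid_prod a m z *
     (rademacher a (fst z) * rademacher (n - m) (snd z))"

lemma cross_term_eq:
  "blank_haar a z * mid_prod a m z * blank_haar m z
    = cross_coeff a m z * (rademacher m (fst z) * rademacher (n - a) (snd z))"
  by (simp add: blank_haar_def cross_coeff_def)

text \<open>A middle factor with index \<open>r\<close> lives at scales \<open>r + 1\<close> and
  \<open>n - r + 1\<close>. As \<open>a < r < m\<close>, these are at most \<open>m\<close> and
  \<open>n - a\<close>.\<close>

lemma cell_const_cross_coeff:
  assumes "a < m" "m \<le> n"
  shows "cell_const m (n - a) (cross_coeff a m)"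
proof -
  have "cell_const m (n - a) (\<lambda>z. 1 + (1/8) * blank_haar r z)" if "r \<in> {a<..<m}" for r
    by (intro cell_const_add cell_const_mult cell_const_const
        cell_const_mono[OF cell_const_blank_haar]) (use that assms in auto)
  then have "cell_const m (n - a) (mid_prod a m)"
    unfolding mid_prod_def[abs_def] by (intro cell_const_prod) simp
  then show ?thesis
    unfolding cross_coeff_def[abs_def]
    by (intro cell_const_mult
        cell_const_mono[OF cell_const_blank[of a]] cell_const_mono[OF cell_const_blank[of m]]
        cell_const_mono[OF cell_const_rademacher_fst[of a 0]]
        cell_const_mono[OF cell_const_rademacher_snd[of 0 "n - m"]]) (use assms in auto)
qed

lemma abs_cross_coeff_le: "\<bar>cross_coeff a m z\<bar> \<le> (9/8) ^ (m - Suc a)"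
proof -
  have "\<bar>cross_coeff a m z\<bar> \<le> 1 * 1 * (9/8) ^ (m - Suc a) * (1 * 1)"
    unfolding cross_coeff_def abs_mult
    by (intro mult_mono abs_blank_le_1 abs_rademacher_le_1 abs_mid_prod_le mult_nonneg_nonneg abs_ge_zero)
      auto
  then show ?thesis by simp
qed

section \<open>Integrals of the terms of the expansion\<close>

lemma integral_blank_haar: "has_bochner_integral lborel (blank_haar m) 0"
  using has_bochner_integral_minus[OF integral_cell_const[OF cell_const_blank[of m]]]
  by (simp add: blank_haar_def[abs_def])

lemma integral_cross_term:
  assumes "a < m" "m \<le> n"
  shows "has_bochner_integral lborel (\<lambda>z. blank_haar a z * mid_prod a m z * blank_haar m z) 0"
  unfolding cross_term_eq by (rule integral_cell_const[OF cell_const_cross_coeff[OF assms]])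

text \<open>All terms of the expansion have mean zero, so \<open>riesz\<close> has mass 1 on the
  unit square.\<close>

lemma integral_riesz: "has_bochner_integral lborel (\<lambda>z. riesz z - 1) 0"
proof -
  have "has_bochner_integral lborel (\<lambda>z. \<Sum>m<Suc n. blank_haar m z / 8 +
     (\<Sum>a<m. (blank_haar a z * mid_prod a m z * blank_haar m z) / 64)) (\<Sum>m<Suc n. 0 / 8 + (\<Sum>a<m. 0 / 64))"
    by (intro has_bochner_integral_sum has_bochner_integral_add has_bochner_integral_divide
        integral_blank_haar integral_cross_term) auto
  then show ?thesis by (simp add: riesz_expansion)
qed

text \<open>Each point occupies at most one of the \<open>2 ^ n\<close> boxes, so at most
  \<open>card A\<close>, hence at most half of them, are occupied.\<close>

lemma sum_blank_ge:
  assumes "m \<le> n"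
  shows "2 ^ n / 2 \<le> (\<Sum>i<2^m. \<Sum>j<2^(n-m). blank m (real i / 2 ^ m, real j / 2 ^ (n - m)))"
proof -
  let ?I = "{..<(2::nat)^m} \<times> {..<(2::nat)^(n-m)}"
  define B where "B = {ij \<in> ?I. blank m (real (fst ij) / 2 ^ m, real (snd ij) / 2 ^ (n - m)) = 0}"
  have "B \<subseteq> (\<lambda>a. (nat \<lfloor>2 ^ m * fst a\<rfloor>, nat \<lfloor>2 ^ (n - m) * snd a\<rfloor>)) ` A"
  proof
    fix ij assume "ij \<in> B"
    then obtain a where a: "a \<in> A" "\<lfloor>2 ^ m * fst a\<rfloor> = int (fst ij)" "\<lfloor>2 ^ (n - m) * snd a\<rfloor> = int (snd ij)"
      unfolding B_def blank_def by (auto split: if_splits)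
    show "ij \<in> (\<lambda>a. (nat \<lfloor>2 ^ m * fst a\<rfloor>, nat \<lfloor>2 ^ (n - m) * snd a\<rfloor>)) ` A"
      by (rule image_eqI[OF _ a(1)]) (simp add: a)
  qed
  then have cB: "card B \<le> card A"
    using finite_A by (meson card_image_le card_mono finite_imageI order_trans)
  have "(\<Sum>i<2^m. \<Sum>j<2^(n-m). blank m (real i / 2 ^ m, real j / 2 ^ (n - m)))
      = (\<Sum>ij\<in>?I. blank m (real (fst ij) / 2 ^ m, real (snd ij) / 2 ^ (n - m)))"
    by (simp add: sum.cartesian_product split_beta)
  also have "\<dots> = (\<Sum>ij\<in>?I. 1 - (if ij \<in> B then 1 else 0))"
    by (intro sum.cong refl) (auto simp: B_def blank_def)
  also have "\<dots> = real (card ?I) - real (card B)"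
    by (simp add: sum_subtractf sum.If_cases Int_absorb1 B_def Int_def conj_commute)
  also have "real (card ?I) = 2 ^ n"
    using assms by (simp flip: power_add)
  finally have sum: "(\<Sum>i<2^m. \<Sum>j<2^(n-m). blank m (real i / 2 ^ m, real j / 2 ^ (n - m)))
      = 2 ^ n - real (card B)" .
  have "real (2 * card A) \<le> real (2 ^ n)"
    using card_upper by (simp only: of_nat_le_iff)
  then show ?thesis
    unfolding sum using cB by simp
qed

lemma discrepancy_blank_haar:
  assumes "m \<le> n"
  shows "integrable lborel (\<lambda>z. discrepancy A z * blank_haar m z)"
    and "real (card A) / (32 * 2 ^ n) \<le> (\<integral>z. discrepancy A z * blank_haar m z \<partial>lborel)"
proof -
  let ?S = "\<Sum>i<2^m. \<Sum>j<2^(n-m). blank m (real i / 2 ^ m, real j / 2 ^ (n - m))"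
  have *: "has_bochner_integral lborel (\<lambda>z. discrepancy A z * blank_haar m z)
    (?S * (real (card A) / (16 * 4 ^ n)))"
    using has_bochner_integral_minus[OF discrepancy_cell_const[OF A_subset finite_A
          cell_const_blank[of m] blank_point]] assms
    by (simp add: blank_haar_def[abs_def])
  then show "integrable lborel (\<lambda>z. discrepancy A z * blank_haar m z)"
    by (simp add: has_bochner_integral_iff)
  have "real (card A) / (32 * 2 ^ n) = 2 ^ n / 2 * (real (card A) / (16 * (2 ^ n * 2 ^ n)))"
    by simp
  also have "2 ^ n * 2 ^ n = (4 ^ n :: real)"
    by (simp flip: power_mult_distrib)
  also have "2 ^ n / 2 * (real (card A) / (16 * 4 ^ n)) \<le> ?S * (real (card A) / (16 * 4 ^ n))"
    using sum_blank_ge[OF assms] by (intro mult_right_mono) auto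
  finally show "real (card A) / (32 * 2 ^ n) \<le> (\<integral>z. discrepancy A z * blank_haar m z \<partial>lborel)"
    using * by (simp add: has_bochner_integral_iff)
qed

text \<open>The cells are finer than area \<open>2 ^ -n\<close> by the factor
  \<open>2 ^ (m - a)\<close>. This gain beats the growth of the middle product, leaving the ratio
  9/16.\<close>

lemma discrepancy_cross_term:
  assumes "a < m" "m \<le> n"
  shows "integrable lborel (\<lambda>z. discrepancy A z * (blank_haar a z * mid_prod a m z * blank_haar m z))"
    and "\<bar>\<integral>z. discrepancy A z * (blank_haar a z * mid_prod a m z * blank_haar m z) \<partial>lborel\<bar>
      \<le> real (card A) / (32 * 2 ^ n) * (9/16) ^ (m - Suc a)"
proof -
  note cc = cell_const_cross_coeff[OF assms]
  have free: "cross_coeff a m z = 0" if "z \<in> A" for z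
    using blank_point[OF that] by (simp add: cross_coeff_def)
  show "integrable lborel (\<lambda>z. discrepancy A z * (blank_haar a z * mid_prod a m z * blank_haar m z))"
    using discrepancy_cell_const[OF A_subset finite_A cc free]
    unfolding cross_term_eq by (simp add: has_bochner_integral_iff)
  have "\<bar>\<integral>z. discrepancy A z * (blank_haar a z * mid_prod a m z * blank_haar m z) \<partial>lborel\<bar>
      \<le> real (card A) * (9/8) ^ (m - Suc a) / (16 * 2 ^ (m + (n - a)))"
    unfolding cross_term_eq
    by (rule abs_integral_discrepancy_cell_const_le[OF A_subset finite_A cc free abs_cross_coeff_le])
  \<comment> \<open>One factor 2 is split off to turn 16 into 32, giving the same constant as in
    \<open>discrepancy_blank_haar\<close>.\<close>
  also have "m + (n - a) = n + Suc (m - Suc a)"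
    using assms by simp
  also have "real (card A) * (9/8) ^ (m - Suc a) / (16 * 2 ^ (n + Suc (m - Suc a)))
      = real (card A) / (32 * 2 ^ n) * ((9/8) ^ (m - Suc a) / 2 ^ (m - Suc a))"
    by (simp add: power_add)
  also have "(9/8 :: real) ^ (m - Suc a) / 2 ^ (m - Suc a) = (9/16) ^ (m - Suc a)"
    by (simp flip: power_divide)
  finally show "\<bar>\<integral>z. discrepancy A z * (blank_haar a z * mid_prod a m z * blank_haar m z) \<partial>lborel\<bar>
      \<le> real (card A) / (32 * 2 ^ n) * (9/16) ^ (m - Suc a)" .
qed

lemma discrepancy_riesz:
  shows "integrable lborel (\<lambda>z. discrepancy A z * (riesz z - 1))"
    and "(real n + 1) / 2048 \<le> (\<integral>z. discrepancy A z * (riesz z - 1) \<partial>lborel)"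
proof -
  define c where "c = real (card A) / (32 * 2 ^ n)"
  define u where "u m = (\<integral>z. discrepancy A z * blank_haar m z \<partial>lborel)" for m
  define v where "v a m =
    (\<integral>z. discrepancy A z * (blank_haar a z * mid_prod a m z * blank_haar m z) \<partial>lborel)" for a m
  have eq: "discrepancy A z * (riesz z - 1) = (\<Sum>m<Suc n. discrepancy A z * blank_haar m z / 8 +
     (\<Sum>a<m. discrepancy A z * (blank_haar a z * mid_prod a m z * blank_haar m z) / 64))" for z
    unfolding riesz_expansion sum_distrib_left distrib_left times_divide_eq_right ..
  have *: "has_bochner_integral lborel (\<lambda>z. discrepancy A z * (riesz z - 1))
     (\<Sum>m<Suc n. u m / 8 + (\<Sum>a<m. v a m / 64))"
    unfolding eq u_def v_def
    by (intro has_bochner_integral_sum has_bochner_integral_add has_bochner_integral_divide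
        has_bochner_integral_integrable discrepancy_blank_haar discrepancy_cross_term) auto
  then show "integrable lborel (\<lambda>z. discrepancy A z * (riesz z - 1))"
    by (simp add: has_bochner_integral_iff)
  have c0: "0 \<le> c" by (simp add: c_def)
  have "real (2 ^ n) \<le> real (4 * card A)"
    using card_lower by (simp only: of_nat_le_iff)
  then have c: "1 / 128 \<le> c"
    by (simp add: c_def field_simps)
  \<comment> \<open>The cross terms with largest index \<open>m\<close> cost at most
    \<open>c * (16/7) / 64 = c / 28\<close>, and \<open>c / 8 - c / 28\<close> exceeds
    \<open>c / 16\<close>.\<close>
  have "c / 16 \<le> u m / 8 + (\<Sum>a<m. v a m / 64)" if m: "m < Suc n" for m
  proof -
    have "- v a m \<le> c * (9/16) ^ (m - Suc a)" if "a < m" for a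
      using discrepancy_cross_term(2)[of a m] that m unfolding v_def c_def by linarith
    then have "(\<Sum>a<m. - v a m) \<le> (\<Sum>a<m. c * (9/16) ^ (m - Suc a))"
      by (intro sum_mono) auto
    also have "\<dots> = c * (\<Sum>k<m. (9/16) ^ k)"
      by (simp add: sum.nat_diff_reindex flip: sum_distrib_left)
    also have "(\<Sum>k<m. (9/16) ^ k :: real) = (1 - (9/16) ^ m) * (16/7)"
      by (subst sum_gp_strict) (simp add: field_simps)
    also have "\<dots> \<le> 16/7" by simp
    finally have "(\<Sum>a<m. - v a m) \<le> c * (16/7)" using c0 by (simp add: mult_left_mono)
    moreover have "(\<Sum>a<m. v a m / 64) = - (\<Sum>a<m. - v a m) / 64"
      by (simp add: sum_negf sum_divide_distrib)
    moreover have "c \<le> u m"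
      using discrepancy_blank_haar(2)[of m] m unfolding u_def c_def by simp
    ultimately show ?thesis using c0 by linarith
  qed
  then have "(\<Sum>m<Suc n. c / 16) \<le> (\<Sum>m<Suc n. u m / 8 + (\<Sum>a<m. v a m / 64))"
    by (intro sum_mono) auto
  moreover have "(real n + 1) / 2048 \<le> (\<Sum>m<Suc n. c / 16)"
  proof -
    have "(real n + 1) * (1 / 128) \<le> (real n + 1) * c"
      using c by (intro mult_left_mono) auto
    then show ?thesis by (simp add: algebra_simps)
  qed
  ultimately show "(real n + 1) / 2048 \<le> (\<integral>z. discrepancy A z * (riesz z - 1) \<partial>lborel)"
    using * by (simp add: has_bochner_integral_iff)
qed

end

section \<open>Exponential integrability\<close>

text \<open>Beyond \<open>T \<ge> 1\<close> the power grows at rate at least one: splitting off one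
  factor gives \<open>x powr \<alpha> - T powr \<alpha> \<ge> (x - T) * T powr (\<alpha> - 1) \<ge>
  x - T\<close>. This replaces Orlicz duality.\<close>

lemma le_add_exp_powr_diff:
  fixes x T \<alpha> :: real
  assumes "0 \<le> x" "1 \<le> T" "1 \<le> \<alpha>"
  shows "x \<le> T + exp (x powr \<alpha> - T powr \<alpha>)"
proof (cases "x \<le> T")
  case True
  then show ?thesis by (intro order_trans[OF True]) simp
next
  case False
  have split: "u powr \<alpha> = u * u powr (\<alpha> - 1)" if "1 \<le> u" for u :: real
    using powr_add[of u 1 "\<alpha> - 1"] that by simp
  have split_x: "x powr \<alpha> = x * x powr (\<alpha> - 1)" and split_T: "T powr \<alpha> = T * T powr (\<alpha> - 1)"
    using False assms by (auto intro!: split)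
  have "T powr (\<alpha> - 1) \<le> x powr (\<alpha> - 1)"
    using False assms by (intro powr_mono2) auto
  then have "(x - T) * T powr (\<alpha> - 1) \<le> x * x powr (\<alpha> - 1) - T * T powr (\<alpha> - 1)"
    using assms by (simp add: left_diff_distrib mult_left_mono)
  moreover have "(x - T) * 1 \<le> (x - T) * T powr (\<alpha> - 1)"
    using False assms by (intro mult_left_mono ge_one_powr_ge_zero) auto
  ultimately have "x - T \<le> x powr \<alpha> - T powr \<alpha>"
    unfolding split_x split_T mult_1_right by (rule order_trans[rotated])
  moreover have "x powr \<alpha> - T powr \<alpha> \<le> exp (x powr \<alpha> - T powr \<alpha>)"
    using exp_ge_add_one_self[of "x powr \<alpha> - T powr \<alpha>"] by linarith
  ultimately show ?thesis by linarith
qed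

lemma le_exp_powr:
  fixes x \<alpha> :: real
  assumes "0 \<le> x" "1 \<le> \<alpha>"
  shows "x \<le> exp (x powr \<alpha>)"
proof (cases "x \<le> 1")
  case True
  then show ?thesis
    by (intro order_trans[OF True]) simp
next
  case False
  then have "x powr 1 \<le> x powr \<alpha>" using assms by (intro powr_mono) auto
  then have "x \<le> x powr \<alpha>" using assms by simp
  then show ?thesis
    using exp_ge_add_one_self[of "x powr \<alpha>"] by linarith
qed

lemma integral_indicator_unit_square:
  "has_bochner_integral lborel (indicator unit_square :: real \<times> real \<Rightarrow> real) 1"
proof -
  have "has_bochner_integral lborel (indicator {0..1::real} :: real \<Rightarrow> real) 1"
    by (simp add: has_bochner_integral_iff)
  from has_bochner_integral_fst_times_snd[OF this this] show ?thesis
    by (simp add: unit_square_def indicator_times[abs_def] split_beta)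
qed

lemma borel_measurable_discrepancy:
  assumes "A \<subseteq> unit_square" "finite A"
  shows "discrepancy A \<in> borel_measurable borel"
proof -
  have "(\<lambda>z. (\<Sum>a\<in>A. of_bool (fst a < fst z) * of_bool (snd a < snd z))
      - real (card A) * (fst z * snd z)) \<in> borel_measurable (borel \<Otimes>\<^sub>M borel)"
    by measurable
  then show ?thesis
    by (simp add: discrepancy_eq[OF assms, abs_def] borel_prod)
qed

section \<open>Lower bound for admissible \<open>K\<close>\<close>

context riesz_product
begin

lemma exp_L_admissible_lower_bound:
  fixes \<alpha> K :: real
  assumes \<alpha>: "1 \<le> \<alpha>" and K: "0 < K" and n: "1 \<le> n"
    and adm: "(\<integral>\<^sup>+ z. ennreal (psi \<alpha> (discrepancy A z / K)) \<partial>(lebesgue_on unit_square)) \<le> 1"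
  shows "real n powr (1 - 1 / \<alpha>) / 10240 \<le> K"
proof -
  define T where "T = real n powr (1 / \<alpha>)"
  define F where "F z = indicator unit_square z * psi \<alpha> (discrepancy A z / K)" for z
  define I where "I = integral\<^sup>L lborel F"
  note [measurable] = borel_measurable_discrepancy[OF A_subset finite_A]
  have sq [measurable]: "unit_square \<in> sets borel"
    by (simp add: unit_square_def closed_Times borel_closed)
  have T1: "1 \<le> T"
    using n \<alpha> unfolding T_def by (intro ge_one_powr_ge_zero) auto
  have T\<alpha>: "T powr \<alpha> = real n"
    using n \<alpha> by (simp add: T_def powr_powr)
  have F_nonneg: "0 \<le> F z" for z
    by (simp add: F_def psi_def)
  have F_meas [measurable]: "F \<in> borel_measurable lborel"
    unfolding F_def psi_def by measurable
  \<comment> \<open>Completing the measure does not change the integral, so the Lebesgue hypothesis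
    can be used with Borel integrals.\<close>
  have "(\<integral>\<^sup>+ z. ennreal (F z) \<partial>lborel)
      = (\<integral>\<^sup>+ z. ennreal (psi \<alpha> (discrepancy A z / K)) * indicator unit_square z \<partial>lebesgue)"
    unfolding nn_integral_completion
    by (intro nn_integral_cong) (auto simp: F_def indicator_def)
  also have "\<dots> \<le> 1"
    using adm sq by (subst (asm) nn_integral_restrict_space) auto
  finally have F1: "(\<integral>\<^sup>+ z. ennreal (F z) \<partial>lborel) \<le> 1" .
  then have F_int: "integrable lborel F"
    by (intro integrableI_nonneg) (auto simp: F_nonneg le_less_trans)
  have I1: "I \<le> 1"
    using F1 nn_integral_eq_integral[OF F_int] F_nonneg by (simp add: I_def)
  \<comment> \<open>The bound on \<open>riesz\<close> must match
    \<open>exp (T powr \<alpha>) = exp n\<close> exactly, so that it cancels the factor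
    \<open>exp (- n)\<close> below. The extra factor 9/8 is absorbed using
    \<open>n \<ge> 1\<close>.\<close>
  have exp_bound: "(9/8) ^ Suc n \<le> exp (real n)"
  proof -
    have "(9/8 :: real) ^ Suc n \<le> (9/8) ^ (2 * n)"
      using n by (intro power_increasing) auto
    also have "\<dots> = (81/64) ^ n" by (simp add: power_mult power2_eq_square)
    also have "\<dots> \<le> exp 1 ^ n"
      using exp_ge_add_one_self[of "1::real"] by (intro power_mono) auto
    finally show ?thesis by (simp flip: exp_of_nat_mult)
  qed
  \<comment> \<open>On the square \<open>R\<close> equals \<open>K * (T * riesz + 2 * E)\<close>
    with \<open>E = exp (\<bar>D / K\<bar> powr \<alpha>)\<close>, and off it \<open>R\<close> is
    zero. The summands are grouped so that each is integrable over the plane.\<close>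
  define R where "R z = K * (T * ((riesz z - 1) + indicator unit_square z)
    + 2 * (F z + indicator unit_square z))" for z
  have R_int: "has_bochner_integral lborel R (K * (T * (0 + 1) + 2 * (I + 1)))"
    unfolding R_def I_def
    by (intro has_bochner_integral_mult_right has_bochner_integral_add integral_riesz
        integral_indicator_unit_square has_bochner_integral_integrable F_int)
  have bound: "discrepancy A z * (riesz z - 1) \<le> R z" for z
  proof (cases "z \<in> unit_square")
    case True
    define X where "X = \<bar>discrepancy A z / K\<bar>"
    define E where "E = exp (X powr \<alpha>)"
    have X0: "0 \<le> X" by (simp add: X_def)
    have "X \<le> T + exp (X powr \<alpha> - real n)"
      using le_add_exp_powr_diff[OF X0 T1 \<alpha>] T\<alpha> by simp
    then have "X * riesz z \<le> (T + exp (X powr \<alpha> - real n)) * riesz z"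
      by (intro mult_right_mono riesz_nonneg)
    also have "\<dots> = T * riesz z + exp (X powr \<alpha> - real n) * riesz z"
      by (simp add: distrib_right)
    also have "exp (X powr \<alpha> - real n) * riesz z \<le> exp (X powr \<alpha> - real n) * exp (real n)"
      using riesz_le[of z] exp_bound by (intro mult_left_mono) auto
    also have "\<dots> = E"
      by (simp add: E_def flip: exp_add)
    finally have 1: "X * riesz z \<le> T * riesz z + E" by simp
    have 2: "X \<le> E"
      unfolding E_def by (rule le_exp_powr[OF X0 \<alpha>])
    have "discrepancy A z * (riesz z - 1) \<le> \<bar>discrepancy A z\<bar> * \<bar>riesz z - 1\<bar>"
      by (metis abs_ge_self abs_mult)
    also have "\<dots> \<le> \<bar>discrepancy A z\<bar> * (riesz z + 1)"
      using riesz_nonneg[of z] by (intro mult_left_mono) auto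
    also have "\<dots> = K * (X * riesz z + X)"
      using K by (simp add: X_def distrib_left)
    also have "\<dots> \<le> K * (T * riesz z + 2 * E)"
      using 1 2 K by (intro mult_left_mono) auto
    also have "\<dots> = R z"
      using True by (simp add: R_def F_def psi_def E_def X_def)
    finally show ?thesis .
  next
    case False
    then show ?thesis by (simp add: riesz_outside R_def F_def)
  qed
  have "(real n + 1) / 2048 \<le> integral\<^sup>L lborel R"
  proof (rule order_trans[OF discrepancy_riesz(2)])
    show "(\<integral>z. discrepancy A z * (riesz z - 1) \<partial>lborel) \<le> integral\<^sup>L lborel R"
      using R_int by (intro integral_mono discrepancy_riesz(1) bound) (simp add: has_bochner_integral_iff)
  qed
  also have "\<dots> = K * (T + 2 * (I + 1))"
    using R_int by (simp add: has_bochner_integral_iff)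
  \<comment> \<open>\<open>T + 2 * (I + 1)\<close> is at most \<open>T + 4\<close>, and
    \<open>T \<ge> 1\<close>. The final constant is \<open>10240 = 5 * 2048\<close>.\<close>
  also have "\<dots> \<le> K * (5 * T)"
    using I1 T1 K by (intro mult_left_mono) auto
  finally have "real n / T \<le> 10240 * K"
    using T1 by (simp add: field_simps)
  moreover have "real n powr (1 - 1 / \<alpha>) = real n / T"
    using n by (simp add: T_def powr_diff)
  ultimately show ?thesis by simp
qed

end

section \<open>Choice of the scale \<open>n\<close> and passage to \<open>ln N\<close>\<close>

theorem theorem1p1:
  shows "\<exists>c::real. c > 0 \<and>
    (\<forall>(N::nat) (A :: (real \<times> real) set) (\<alpha>::real).
       N \<ge> 2 \<longrightarrow> A \<subseteq> unit_square \<longrightarrow> finite A \<longrightarrow> card A = N \<longrightarrow> \<alpha> \<ge> 2 \<longrightarrow>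
       exp_L_norm \<alpha> (discrepancy A) \<ge> ennreal (c * ln (real N) powr (1 - 1 / \<alpha>)))"
proof (intro exI[of _ "1 / 10240"] conjI allI impI)
  fix N :: nat and A :: "(real \<times> real) set" and \<alpha> :: real
  assume N: "N \<ge> 2" and A: "A \<subseteq> unit_square" "finite A" "card A = N" and \<alpha>: "\<alpha> \<ge> 2"
  define n where "n = (LEAST n. 2 * N \<le> 2 ^ n)"
  have "2 * N \<le> 2 ^ (2 * N)"
    using less_exp[of "2 * N"] by simp
  then have up: "2 * N \<le> 2 ^ n"
    unfolding n_def by (rule LeastI)
  then have n1: "1 \<le> n"
    using N by (cases n) auto
  \<comment> \<open>Minimality of \<open>n\<close> supplies the second locale bound: doubling
    \<open>2 ^ (n - 1) < 2 * N\<close> gives \<open>2 ^ n \<le> 4 * N\<close>.\<close>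
  have "\<not> 2 * N \<le> 2 ^ (n - 1)"
    using n1 not_less_Least[of "n - 1" "\<lambda>n. 2 * N \<le> 2 ^ n", folded n_def] by simp
  then have low: "2 ^ n \<le> 4 * N"
    using n1 by (cases n) auto
  interpret riesz_product A n
    by unfold_locales (use A up low in auto)
  have "real (2 * N) \<le> real (2 ^ n)"
    using up by (simp only: of_nat_le_iff)
  also have "\<dots> \<le> exp 1 ^ n"
    using exp_ge_add_one_self[of "1::real"] by (simp add: power_mono)
  finally have "real N \<le> exp (real n)"
    by (simp flip: exp_of_nat_mult)
  then have "ln (real N) \<le> ln (exp (real n))"
    using N by (subst ln_le_cancel_iff) auto
  then have "ln (real N) \<le> real n" by simp
  then have ln: "ln (real N) powr (1 - 1 / \<alpha>) \<le> real n powr (1 - 1 / \<alpha>)"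
    using N \<alpha> by (intro powr_mono2) auto
  show "exp_L_norm \<alpha> (discrepancy A) \<ge> ennreal (1 / 10240 * ln (real N) powr (1 - 1 / \<alpha>))"
    unfolding exp_L_norm_def
  \<comment> \<open>Bounding every admissible \<open>K\<close> also covers the case of no admissible
    \<open>K\<close>, where the infimum is infinite.\<close>
  proof (intro Inf_greatest, clarify)
    fix K :: real
    assume K: "K > 0"
      "(\<integral>\<^sup>+ x. ennreal (psi \<alpha> (discrepancy A x / K)) \<partial>(lebesgue_on unit_square)) \<le> 1"
    have "real n powr (1 - 1 / \<alpha>) / 10240 \<le> K"
      using \<alpha> by (intro exp_L_admissible_lower_bound[OF _ K(1) n1 K(2)]) simp
    with ln show "ennreal (1 / 10240 * ln (real N) powr (1 - 1 / \<alpha>)) \<le> ennreal K"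
      by (intro ennreal_leI) simp
  qed
qed simp

end
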